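(* (i) For all $y\in\mathbb R^3$, $$\frac{c_1\chi_1^{-1}|y|}{(1+|y|)^a}\le |X(y)|\le \frac{c_2\chi_1^a|y|}{(1+|y|)^a},$$ where $c_1=\min\{1,\chi_0\}^a$ and $c_2=2^a c_1^{-1}\min\{a_0,a_N\}^{-1}$. Alternatively, for all $y\in\mathbb R^3$, $$\chi_1^{-(1-a)}|y|^{1-a}-1\le |X(y)|\le c_3|y|^{1-a},$$ where $c_3=(a_N)^{a-1}$. (ii) For all $y\in\mathbb R^3$, $$\frac{c_4\chi_1^{-2}|y|^2}{(1+|y|)^a}\le X(y)\cdot y\le \frac{c_2\chi_1^a|y|^2}{(1+|y|)^a},$$ where $c_4=(\min\{1,a_0,a_N\}/2^{\alpha_N})^{1+a}$. Alternatively, for all $y\in\mathbb R^3$, $$c_5\chi_1^{-2}(|y|^{2-a}-1)\le X(y)\cdot y\le c_3|y|^{2-a},$$ where $c_5=2^{-a}c_4$.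
   Context: $N\ge1$ is an integer, $0=\alpha_0<\alpha_1<\dots<\alpha_N$ are real numbers, $a_0,\dots,a_N>0$ are constants, and $g(s)=\sum_{i=0}^N a_is^{\alpha_i}$ for $s\ge0$. $\vec k\in\mathbb R^3$ is a fixed unit vector, $\mathbf J$ is the $3\times3$ matrix with $\mathbf Jx=\vec k\times x$ for all $x\in\mathbb R^3$, and $\mathcal R\ge0$ is a constant. The function $F:\mathbb R^3\to\mathbb R^3$, $F(v)=g(|v|)v+\mathcal R\,\mathbf Jv$, is a bijection, and $X=F^{-1}$. Further, $a=\frac{\alpha_N}{1+\alpha_N}\in(0,1)$, $\chi_0=g(1)=\sum_{i=0}^Na_i$ and $\chi_1=\chi_0+\mathcal R$. *)

theory Defs
  imports "HOL-Analysis.Analysis"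
begin

text \<open>A real power of a nonnegative base with \<open>s\<^sup>0 = 1\<close> also for \<open>s = 0\<close>;
  \<^const>\<open>powr\<close> has \<open>0 powr 0 = 0\<close>, which would give \<open>g 0 = 0\<close> instead of \<open>g 0 = a 0\<close>.\<close>

definition rpow :: "real \<Rightarrow> real \<Rightarrow> real"
  where "rpow s e = (if e = 0 then 1 else s powr e)"

definition gen_poly :: "nat \<Rightarrow> (nat \<Rightarrow> real) \<Rightarrow> (nat \<Rightarrow> real) \<Rightarrow> real \<Rightarrow> real"
  where "gen_poly N \<alpha> a s = (\<Sum>i\<le>N. a i * rpow s (\<alpha> i))"

definition rot_map :: "(real \<Rightarrow> real) \<Rightarrow> real \<Rightarrow> real^3^3 \<Rightarrow> real^3 \<Rightarrow> real^3"
  where "rot_map g R J v = g (norm v) *\<^sub>R v + R *\<^sub>R (J *v v)"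

end

theory Submission
  imports Defs
begin

text \<open>
  For \<open>y = F v\<close>, skew-symmetry of \<open>J\<close> gives \<open>v \<bullet> y = g \<bar>v\<bar> \<bar>v\<bar>\<^sup>2\<close>, hence
  \<open>g \<bar>v\<bar> \<bar>v\<bar> \<le> \<bar>y\<bar> \<le> (g \<bar>v\<bar> + R) \<bar>v\<bar>\<close>. Combined with
  \<open>a\<^sub>0 + a\<^sub>N s\<^sup>A \<le> g s \<le> \<chi>\<^sub>0 (max 1 s)\<^sup>A\<close>, where \<open>A = \<alpha>\<^sub>N\<close>, every bound becomes an inequality
  between the two numbers \<open>s = \<bar>v\<bar>\<close> and \<open>r = \<bar>y\<bar>\<close>. Surjectivity of \<open>F\<close> follows from the
  intermediate value theorem: for fixed \<open>s\<close> the linear map \<open>g s + R J\<close> has an explicit inverse,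
  and one looks for \<open>s\<close> equal to the norm of the preimage of \<open>y\<close>.
\<close>

section \<open>The generalized polynomial\<close>

lemma rpow_nonneg: "0 \<le> rpow s e"
  by (simp add: rpow_def)

lemma rpow_one [simp]: "rpow 1 e = 1"
  by (simp add: rpow_def)

text \<open>\<open>powr\<close> is nonnegative for every real base, so all summands are nonnegative
  and those other than \<open>i = 0\<close> and \<open>i = N\<close> may be dropped.\<close>

lemma gen_poly_lower:
  assumes "N \<ge> 1" "\<alpha> 0 = 0" "\<alpha> N > 0" "\<And>i. i \<le> N \<Longrightarrow> a i > 0"
  shows "a 0 + a N * s powr \<alpha> N \<le> gen_poly N \<alpha> a s"
proof -
  have "(\<Sum>i\<in>{0, N}. a i * rpow s (\<alpha> i)) \<le> gen_poly N \<alpha> a s"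
    unfolding gen_poly_def
    by (rule sum_mono2) (use assms(4) rpow_nonneg in \<open>auto simp: less_imp_le\<close>)
  then show ?thesis
    using assms by (simp add: rpow_def)
qed

lemma gen_poly_upper:
  assumes "0 \<le> s" "\<And>i. i \<le> N \<Longrightarrow> 0 \<le> \<alpha> i \<and> \<alpha> i \<le> \<alpha> N" "\<And>i. i \<le> N \<Longrightarrow> a i > 0"
  shows "gen_poly N \<alpha> a s \<le> gen_poly N \<alpha> a 1 * max 1 s powr \<alpha> N"
proof -
  \<comment> \<open>Passing to the base \<open>max 1 s\<close> makes powers monotone in the
    exponent. The factor \<open>rpow 1 (\<alpha> i)\<close>, equal to 1, makes the termwise bounds
    add up to \<open>gen_poly N \<alpha> a 1\<close>.\<close>
  have "rpow s (\<alpha> i) \<le> rpow 1 (\<alpha> i) * max 1 s powr \<alpha> N" if "i \<le> N" for i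
  proof -
    have "rpow s (\<alpha> i) \<le> max 1 s powr \<alpha> i"
      using assms(1) assms(2)[OF that] by (auto simp: rpow_def intro!: powr_mono2)
    also have "\<dots> \<le> max 1 s powr \<alpha> N"
      using assms(2)[OF that] by (intro powr_mono) auto
    finally show ?thesis
      by simp
  qed
  then show ?thesis
    unfolding gen_poly_def sum_distrib_right mult.assoc
    by (intro sum_mono mult_left_mono) (auto intro: less_imp_le assms(3))
qed

lemma continuous_on_gen_poly:
  assumes "\<And>i. i \<le> N \<Longrightarrow> 0 \<le> \<alpha> i"
  shows "continuous_on {0..} (gen_poly N \<alpha> a)"
proof -
  have "continuous_on {0..} (\<lambda>s. rpow s (\<alpha> i))" if "i \<le> N" for i
    using assms[OF that]
    by (cases "\<alpha> i = 0") (auto simp: rpow_def intro!: continuous_on_powr' continuous_on_id continuous_on_const)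
  then show ?thesis
    unfolding gen_poly_def by (auto intro!: continuous_intros)
qed

section \<open>Norm bounds and surjectivity of the map\<close>

lemma inner_scale_add_cross3:
  "v \<bullet> (c *\<^sub>R v + R *\<^sub>R cross3 k v) = c * (norm v)\<^sup>2"
  by (simp add: inner_add_right dot_cross_self power2_norm_eq_inner)

lemma norm_scale_add_cross3:
  assumes "norm k = 1" "0 \<le> c" "0 \<le> R"
  shows "c * norm v \<le> norm (c *\<^sub>R v + R *\<^sub>R cross3 k v)"
    and "norm (c *\<^sub>R v + R *\<^sub>R cross3 k v) \<le> (c + R) * norm v"
proof -
  let ?w = "c *\<^sub>R v + R *\<^sub>R cross3 k v"
  have "norm v * (c * norm v) \<le> norm v * norm ?w"
    using norm_cauchy_schwarz[of v ?w] inner_scale_add_cross3[of v c R k]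
    by (simp add: power2_eq_square mult_ac)
  then show "c * norm v \<le> norm ?w"
    by (cases "v = 0") auto
  \<comment> \<open>Lagrange's identity for a unit vector \<open>k\<close>: \<open>cross3 k\<close>
    does not increase norms.\<close>
  have "(norm (cross3 k v))\<^sup>2 + (k \<bullet> v)\<^sup>2 = (norm v)\<^sup>2"
    using norm_cross_dot[of k v] assms(1) by simp
  then have "(norm (cross3 k v))\<^sup>2 \<le> (norm v)\<^sup>2"
    using zero_le_power2[of "k \<bullet> v"] by linarith
  then have "norm (cross3 k v) \<le> norm v"
    using power2_le_imp_le norm_ge_zero by blast
  then have "R * norm (cross3 k v) \<le> R * norm v"
    using assms by (intro mult_left_mono)
  then show "norm ?w \<le> (c + R) * norm v"
    using norm_triangle_ineq[of "c *\<^sub>R v" "R *\<^sub>R cross3 k v"] assms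
    by (simp add: algebra_simps)
qed

lemma surj_scale_add_cross3:
  assumes k: "norm k = 1" and "0 < c0" "0 \<le> R"
    and g: "continuous_on {0..} g" "\<And>s. 0 \<le> s \<Longrightarrow> c0 \<le> g s"
  shows "\<exists>v. g (norm v) *\<^sub>R v + R *\<^sub>R cross3 k v = y"
proof -
  \<comment> \<open>On the plane orthogonal to \<open>k\<close>, the map \<open>cross3 k\<close>
    squares to -1, so \<open>c + R * cross3 k\<close> is inverted like the complex number c + iR:
    conjugate over squared modulus. The last summand corrects the component along \<open>k\<close>
    to \<open>(k \<bullet> y) / c\<close>.\<close>
  define h where "h s = (1 / ((g s)\<^sup>2 + R\<^sup>2)) *\<^sub>R
    (g s *\<^sub>R y - R *\<^sub>R cross3 k y + (R\<^sup>2 / g s * (k \<bullet> y)) *\<^sub>R k)" for s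
  have pos: "0 < g s" if "0 \<le> s" for s
    using g(2)[OF that] \<open>0 < c0\<close> by linarith
  have kk: "k \<bullet> k = 1"
    using k by (simp add: dot_square_norm)
  have sol: "g s *\<^sub>R h s + R *\<^sub>R cross3 k (h s) = y" if "0 \<le> s" for s
  proof -
    define c where "c = g s"
    define D where "D = c\<^sup>2 + R\<^sup>2"
    have "c > 0" "D > 0"
      using pos[OF that] by (auto simp: c_def D_def add_pos_nonneg)
    define z where "z = c *\<^sub>R y - R *\<^sub>R cross3 k y + (R\<^sup>2 / c * (k \<bullet> y)) *\<^sub>R k"
    have "cross3 k (cross3 k y) = (k \<bullet> y) *\<^sub>R k - y"
      using kk by (simp add: Lagrange)
    then have "cross3 k z = c *\<^sub>R cross3 k y - R *\<^sub>R ((k \<bullet> y) *\<^sub>R k - y)"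
      by (simp add: z_def cross_add_right cross_mult_right Cross3.right_diff_distrib)
    then have "c *\<^sub>R z + R *\<^sub>R cross3 k z
        = c *\<^sub>R z + R *\<^sub>R (c *\<^sub>R cross3 k y - R *\<^sub>R ((k \<bullet> y) *\<^sub>R k - y))"
      by simp
    also have "\<dots> = D *\<^sub>R y"
      using \<open>c > 0\<close> by (simp add: z_def D_def algebra_simps power2_eq_square)
    finally have "c *\<^sub>R z + R *\<^sub>R cross3 k z = D *\<^sub>R y" .
    moreover have "h s = (1 / D) *\<^sub>R z"
      by (simp add: h_def z_def D_def c_def)
    ultimately have "c *\<^sub>R h s + R *\<^sub>R cross3 k (h s) = (1 / D) *\<^sub>R D *\<^sub>R y"
      by (metis (no_types) cross_mult_right scaleR_left_commute scaleR_right_distrib)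
    then show ?thesis
      using \<open>D > 0\<close> by (simp add: c_def)
  qed
  have cont: "continuous_on {0..} h"
    unfolding h_def
    by (intro continuous_intros g) (use pos in \<open>fastforce simp: add_nonneg_eq_0_iff\<close>)+
  \<comment> \<open>The function \<open>s - norm (h s)\<close> is at most 0 at \<open>s = 0\<close>.
    Since \<open>c0 * norm (h T) \<le> norm y\<close>, it is at least 0 at this \<open>T\<close>. At
    a zero, \<open>h s\<close> has norm \<open>s\<close> and is the required preimage.\<close>
  define T where "T = norm y / c0"
  have "0 \<le> T"
    using \<open>0 < c0\<close> by (simp add: T_def)
  have "norm (h T) \<le> T"
  proof -
    have "c0 * norm (h T) \<le> g T * norm (h T)"
      using g(2)[OF \<open>0 \<le> T\<close>] by (intro mult_right_mono) auto
    also have "\<dots> \<le> norm y"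
      using norm_scale_add_cross3(1)[OF k _ \<open>0 \<le> R\<close>, of "g T" "h T"] pos[OF \<open>0 \<le> T\<close>]
        sol[OF \<open>0 \<le> T\<close>] by auto
    finally show ?thesis
      using \<open>0 < c0\<close> by (simp add: T_def field_simps)
  qed
  then have "\<exists>s\<ge>0. s \<le> T \<and> s - norm (h s) = 0"
    using \<open>0 \<le> T\<close>
    by (intro IVT') (auto intro!: continuous_intros continuous_on_subset[OF cont])
  then show ?thesis
    using sol by (metis eq_iff_diff_eq_0)
qed

section \<open>Scalar inequalities\<close>

lemma max_powr_le:
  fixes s A :: real
  assumes "0 \<le> s" "0 \<le> A"
  shows "max 1 s powr A \<le> 1 + s powr A"
  by (cases "s \<le> 1") (auto simp: max_def)

section \<open>Consequences of the growth bound alone; \<open>\<kappa>\<close> stands for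
  \<open>chi1\<close>, \<open>s\<close> for \<open>norm v\<close>, \<open>r\<close> for
  \<open>norm y\<close>\<close>

context
  fixes A b \<kappa> r s :: real
  assumes A: "0 < A" and b: "b = A / (1 + A)" and \<kappa>: "0 < \<kappa>"
    and s: "0 \<le> s" and r: "0 \<le> r" and upper: "r \<le> \<kappa> * max 1 s powr A * s"
begin

text \<open>With M = \<open>max 1 s\<close>, the power \<open>1 - b\<close> turns M^(1+A) into M,
  and the power \<open>b\<close> turns it into M^A.\<close>

lemma exponent_eqs:
  shows "0 < b" "b < 1" "(1 + A) * b = A" "(1 + A) * (1 - b) = 1"
  using A by (auto simp: b field_simps)

lemma powr_1A: "0 \<le> x \<Longrightarrow> x powr (1 + A) = x powr A * x"
  by (cases "x = 0") (auto simp: powr_add)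

lemma upper_max: "r \<le> \<kappa> * max 1 s powr (1 + A)"
proof -
  have "\<kappa> * max 1 s powr A * s \<le> \<kappa> * max 1 s powr A * max 1 s"
    using \<kappa> by (intro mult_left_mono) auto
  then show ?thesis
    using upper by (simp add: powr_1A)
qed

lemma root_lower: "\<kappa> powr (- (1 - b)) * r powr (1 - b) - 1 \<le> s"
proof -
  have "r powr (1 - b) \<le> (\<kappa> * max 1 s powr (1 + A)) powr (1 - b)"
    using r exponent_eqs upper_max by (intro powr_mono2) auto
  also have "\<dots> = \<kappa> powr (1 - b) * max 1 s"
    using \<kappa> exponent_eqs(4) by (simp add: powr_mult powr_powr)
  finally have "inverse (\<kappa> powr (1 - b)) * r powr (1 - b) \<le> max 1 s"
    using \<kappa> by (simp add: field_simps)
  then have "\<kappa> powr (- (1 - b)) * r powr (1 - b) \<le> max 1 s"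
    by (simp only: powr_minus)
  \<comment> \<open>The summand -1 of the claim comes from
    \<open>max 1 s \<le> 1 + s\<close>.\<close>
  then show ?thesis
    using s by linarith
qed

text \<open>For \<open>s \<le> 1\<close> the growth bound is linear and
  \<open>m powr b \<le> 1 \<le> (1 + r) powr b\<close>. For \<open>s > 1\<close> the factor
  \<open>r\<close> is split as r^b r^(1-b): the first part is absorbed by
  \<open>(1 + r) powr b\<close>, the second is bounded by a multiple of \<open>s\<close>.\<close>

lemma quotient_lower:
  assumes "0 < m" "m \<le> 1" "m \<le> \<kappa>"
  shows "m powr b * inverse \<kappa> * r / (1 + r) powr b \<le> s"
proof -
  have "m powr b * r \<le> \<kappa> * s * (1 + r) powr b"
  proof (cases "s \<le> 1")
    case True
    have "m powr b * r \<le> 1 * r"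
      using assms r exponent_eqs by (intro mult_right_mono powr_le1) auto
    also have "\<dots> \<le> \<kappa> * s * 1"
      using upper True by (simp add: max_absorb1)
    also have "\<dots> \<le> \<kappa> * s * (1 + r) powr b"
      using r s \<kappa> exponent_eqs by (intro mult_left_mono ge_one_powr_ge_zero) auto
    finally show ?thesis .
  next
    case False
    have "r powr (1 - b) \<le> (\<kappa> * s powr (1 + A)) powr (1 - b)"
      using r exponent_eqs upper_max False by (intro powr_mono2) (auto simp: max_def)
    also have "\<dots> = \<kappa> powr (1 - b) * s"
      using \<kappa> s exponent_eqs(4) by (simp add: powr_mult powr_powr)
    finally have *: "r powr (1 - b) \<le> \<kappa> powr (1 - b) * s" .
    have "r = r powr b * r powr (1 - b)"
      using r by (simp flip: powr_add)
    then have "m powr b * r = m powr b * (r powr b * r powr (1 - b))"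
      by simp
    also have "\<dots> \<le> \<kappa> powr b * ((1 + r) powr b * (\<kappa> powr (1 - b) * s))"
      using assms r exponent_eqs * by (intro mult_mono powr_mono2) auto
    also have "\<dots> = (\<kappa> powr b * \<kappa> powr (1 - b)) * s * (1 + r) powr b"
      by (simp add: mult_ac)
    also have "\<kappa> powr b * \<kappa> powr (1 - b) = \<kappa>"
      using \<kappa> by (simp flip: powr_add)
    finally show ?thesis .
  qed
  then show ?thesis
    using \<kappa> r by (simp add: field_simps)
qed

section \<open>Bounds that also use the lower estimate; \<open>\<gamma>\<close> stands for
  \<open>g s\<close>\<close>

context
  fixes \<gamma> \<mu> :: real
  assumes lower: "\<gamma> * s \<le> r" and \<mu>: "0 < \<mu>" and \<gamma>: "\<mu> * (1 + s powr A) \<le> \<gamma>"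
begin

lemma max_le_coeff: "\<mu> * max 1 s powr A \<le> \<gamma>"
proof -
  have "\<mu> * max 1 s powr A \<le> \<mu> * (1 + s powr A)"
    using max_powr_le[OF s] A \<mu> by (intro mult_left_mono) auto
  then show ?thesis
    using \<gamma> by linarith
qed

text \<open>Both 1 and \<open>r\<close> are at most (\<kappa>/m) M^(1+A) with M =
  \<open>max 1 s\<close>, which produces the factors 2^b and m^(-b). After raising to the power
  \<open>b\<close>, M^A is bounded by \<open>\<gamma> / \<mu>\<close>, and
  \<open>\<gamma> * s \<le> r\<close> finishes.\<close>

lemma quotient_upper:
  assumes "0 < m" "m \<le> 1" "m \<le> \<kappa>"
  shows "s \<le> 2 powr b * inverse (m powr b) * inverse \<mu> * \<kappa> powr b * r / (1 + r) powr b"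
proof -
  let ?C = "2 powr b * inverse (m powr b) * \<kappa> powr b"
  have "1 \<le> \<kappa> / m * max 1 s powr (1 + A)"
    using mult_mono[of 1 "\<kappa> / m" 1 "max 1 s powr (1 + A)"] assms A
    by (auto simp: ge_one_powr_ge_zero)
  moreover have "r \<le> \<kappa> / m * max 1 s powr (1 + A)"
  proof -
    have "\<kappa> \<le> \<kappa> / m"
      using assms \<kappa> by (simp add: field_simps)
    then have "\<kappa> * max 1 s powr (1 + A) \<le> \<kappa> / m * max 1 s powr (1 + A)"
      by (intro mult_right_mono) auto
    then show ?thesis
      using upper_max by linarith
  qed
  ultimately have "1 + r \<le> 2 * (\<kappa> / m) * max 1 s powr (1 + A)"
    by linarith
  then have "(1 + r) powr b \<le> (2 * (\<kappa> / m) * max 1 s powr (1 + A)) powr b"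
    using r exponent_eqs by (intro powr_mono2) auto
  also have "\<dots> = ?C * max 1 s powr A"
    using assms \<kappa> exponent_eqs(3) by (simp add: powr_mult powr_divide powr_powr field_simps)
  also have "\<dots> \<le> ?C * (\<gamma> / \<mu>)"
    using max_le_coeff \<mu> by (intro mult_left_mono) (auto simp: field_simps)
  finally have "s * (1 + r) powr b \<le> s * (?C * (\<gamma> / \<mu>))"
    using s by (rule mult_left_mono)
  also have "\<dots> = ?C / \<mu> * (\<gamma> * s)"
    by simp
  also have "\<dots> \<le> ?C / \<mu> * r"
    using lower \<mu> by (intro mult_left_mono) auto
  finally have "s * (1 + r) powr b
      \<le> 2 powr b * inverse (m powr b) * inverse \<mu> * \<kappa> powr b * r"
    by (simp add: divide_inverse mult_ac)
  moreover have "0 < (1 + r) powr b"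
    using r by simp
  ultimately show ?thesis
    by (simp add: pos_le_divide_eq)
qed

text \<open>Squaring the growth bound gives \<kappa>^2 M^(2A) s^2. One factor M^A is absorbed by
  \<open>\<gamma>\<close> at the cost of \<open>\<mu>\<close>, the other by
  \<open>(1 + r) powr b\<close> at the cost of \<open>\<mu> powr b\<close>; hence the exponent
  \<open>1 + b\<close>.\<close>

lemma energy_lower:
  assumes "\<mu> \<le> 1" "c \<le> \<mu> powr (1 + b)"
  shows "c * \<kappa> powi (- 2) * r\<^sup>2 / (1 + r) powr b \<le> \<gamma> * s\<^sup>2"
proof -
  let ?M = "max 1 s"
  have "\<mu> * ?M powr (1 + A) \<le> 1 + r"
  proof (cases "s \<le> 1")
    case True
    then show ?thesis using assms r by simp
  next
    case False
    have "\<mu> * ?M powr A * s \<le> 1 + r"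
      using mult_right_mono[OF max_le_coeff s] lower by linarith
    then show ?thesis
      using False by (simp add: powr_1A max_def mult.assoc)
  qed
  then have "(\<mu> * ?M powr (1 + A)) powr b \<le> (1 + r) powr b"
    using \<mu> exponent_eqs by (intro powr_mono2) auto
  then have P: "\<mu> powr b * ?M powr A \<le> (1 + r) powr b"
    using \<mu> exponent_eqs(3) by (simp add: powr_mult powr_powr)
  have "r\<^sup>2 \<le> (\<kappa> * ?M powr A * s)\<^sup>2"
    using upper r by (rule power_mono)
  then have "c * r\<^sup>2 \<le> \<mu> powr (1 + b) * (\<kappa> * ?M powr A * s)\<^sup>2"
    using assms(2) by (intro mult_mono) auto
  also have "\<dots> = \<kappa>\<^sup>2 * s\<^sup>2 * ((\<mu> * ?M powr A) * (\<mu> powr b * ?M powr A))"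
    using \<mu> by (simp add: powr_add power2_eq_square mult_ac)
  also have "\<dots> \<le> \<kappa>\<^sup>2 * s\<^sup>2 * (\<gamma> * (1 + r) powr b)"
    using P max_le_coeff \<mu> by (intro mult_left_mono mult_mono) (auto intro: order_trans[rotated])
  finally show ?thesis
    using \<kappa> r by (simp add: power_int_minus field_simps)
qed

end

end

text \<open>The hypothesis reads c s^(1+A) \<le> r; the power \<open>1 - b\<close>, the reciprocal
  of 1 + A, solves it for \<open>s\<close>.\<close>

lemma root_upper:
  fixes A b c r s :: real
  assumes "0 < A" "b = A / (1 + A)" "0 < c" "0 \<le> s" and "c * s powr A * s \<le> r"
  shows "s \<le> c powr (b - 1) * r powr (1 - b)"
proof -
  have e: "(1 + A) * (1 - b) = 1" "b < 1"
    using assms(1) unfolding assms(2) by (auto simp: field_simps)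
  have "c * s powr (1 + A) \<le> r"
    using assms(4,5) by (cases "s = 0") (auto simp: powr_add mult_ac)
  then have "(c * s powr (1 + A)) powr (1 - b) \<le> r powr (1 - b)"
    using assms e by (intro powr_mono2) auto
  then have "c powr (1 - b) * s \<le> r powr (1 - b)"
    using assms e by (simp add: powr_mult powr_powr)
  then have "s \<le> inverse (c powr (1 - b)) * r powr (1 - b)"
    using \<open>0 < c\<close> by (simp add: field_simps)
  then show ?thesis
    by (metis minus_diff_eq powr_minus)
qed

text \<open>For \<open>r \<le> 1\<close> the left side is at most 0; for \<open>r > 1\<close> one
  has \<open>1 + r \<le> 2 * r\<close>. This is the source of the factor 2^(-b) in
  \<open>c5\<close>.\<close>

lemma powr_le_quotient:
  fixes r b :: real
  assumes "0 \<le> r" "0 \<le> b" "b \<le> 2"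
  shows "2 powr (- b) * (r powr (2 - b) - 1) \<le> r\<^sup>2 / (1 + r) powr b"
proof (cases "r \<le> 1")
  case True
  then have "r powr (2 - b) \<le> 1"
    using assms by (intro powr_le1) auto
  then have "2 powr (- b) * (r powr (2 - b) - 1) \<le> 0"
    by (intro mult_nonneg_nonpos) auto
  also have "0 \<le> r\<^sup>2 / (1 + r) powr b"
    by simp
  finally show ?thesis .
next
  case False
  have "2 powr (- b) * (r powr (2 - b) - 1) \<le> 2 powr (- b) * r powr (2 - b)"
    by (intro mult_left_mono) auto
  also have "\<dots> = r\<^sup>2 / (2 * r) powr b"
    using False by (simp add: powr_diff powr_mult powr_minus field_simps)
  also have "\<dots> \<le> r\<^sup>2 / (1 + r) powr b"
    using False assms by (intro divide_left_mono powr_mono2) auto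
  finally show ?thesis .
qed

section \<open>Transfer of the scalar inequalities to \<open>X\<close>\<close>

theorem lemma2p1:
  fixes N :: nat and \<alpha> a :: "nat \<Rightarrow> real" and k :: "real^3" and J :: "real^3^3" and R :: real
    and g :: "real \<Rightarrow> real" and F X :: "real^3 \<Rightarrow> real^3"
    and b chi0 chi1 c1 c2 c3 c4 c5 :: real
  assumes "N \<ge> 1"
    and "\<alpha> 0 = 0" and "strict_mono_on {..N} \<alpha>"
    and "\<And>i. i \<le> N \<Longrightarrow> a i > 0"
    and "norm k = 1" and "\<And>x. J *v x = cross3 k x"
    and "R \<ge> 0"
  defines "g \<equiv> gen_poly N \<alpha> a"
    and "F \<equiv> rot_map g R J"
    and "X \<equiv> inv F"
    and "b \<equiv> \<alpha> N / (1 + \<alpha> N)"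
    and "chi0 \<equiv> g 1"
    and "chi1 \<equiv> chi0 + R"
    and "c1 \<equiv> (min 1 chi0) powr b"
    and "c2 \<equiv> 2 powr b * inverse c1 * inverse (min (a 0) (a N))"
    and "c3 \<equiv> (a N) powr (b - 1)"
    and "c4 \<equiv> (Min {1, a 0, a N} / 2 powr (\<alpha> N)) powr (1 + b)"
    and "c5 \<equiv> 2 powr (- b) * c4"
  shows
    "(\<forall>y. c1 * inverse chi1 * norm y / (1 + norm y) powr b \<le> norm (X y)
        \<and> norm (X y) \<le> c2 * chi1 powr b * norm y / (1 + norm y) powr b)
   \<and> (\<forall>y. chi1 powr (- (1 - b)) * norm y powr (1 - b) - 1 \<le> norm (X y)
        \<and> norm (X y) \<le> c3 * norm y powr (1 - b))
   \<and> (\<forall>y. c4 * chi1 powi (- 2) * (norm y)\<^sup>2 / (1 + norm y) powr b \<le> X y \<bullet> y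
        \<and> X y \<bullet> y \<le> c2 * chi1 powr b * (norm y)\<^sup>2 / (1 + norm y) powr b)
   \<and> (\<forall>y. c5 * chi1 powi (- 2) * (norm y powr (2 - b) - 1) \<le> X y \<bullet> y
        \<and> X y \<bullet> y \<le> c3 * norm y powr (2 - b))"
proof -
  have mono: "\<alpha> i \<le> \<alpha> j" if "i \<le> j" "j \<le> N" for i j
    using strict_mono_on_leD[OF assms(3)] that by auto
  have A: "0 < \<alpha> N"
    using strict_mono_onD[OF assms(3), of 0 N] assms(1,2) by auto
  have a: "0 < a 0" "0 < a N"
    using assms(4) by auto
  have g_lower: "a 0 + a N * s powr \<alpha> N \<le> g s" for s
    unfolding g_def by (rule gen_poly_lower) (use assms A in auto)
  have g_upper: "g s \<le> chi0 * max 1 s powr \<alpha> N" if "0 \<le> s" for s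
    unfolding g_def chi0_def using that mono[of 0] mono assms(2,4)
    by (intro gen_poly_upper) auto
  have g_ge: "a 0 \<le> g s" for s
    using g_lower[of s] a by (smt (verit) mult_nonneg_nonneg powr_ge_zero)
  have F: "F v = g (norm v) *\<^sub>R v + R *\<^sub>R cross3 k v" for v
    by (simp add: F_def rot_map_def assms(6))
  have "continuous_on {0..} g"
    unfolding g_def using mono[of 0] assms(2) by (intro continuous_on_gen_poly) auto
  then have "\<exists>v. F v = y" for y
    unfolding F by (rule surj_scale_add_cross3[OF assms(5) a(1) assms(7)]) (rule g_ge)
  then have "surj F"
    by (metis surj_def)
  \<comment> \<open>Surjectivity makes \<open>inv F\<close> a right inverse, so
    \<open>v = X y\<close> solves \<open>F v = y\<close>.\<close>
  then have FX: "F (X y) = y" for y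
    unfolding X_def by (rule surj_f_inv_f)
  have chi: "0 < chi0" "chi0 \<le> chi1"
    using g_ge[of 1] a assms(7) by (auto simp: chi0_def chi1_def)
  define m where "m = min 1 chi0"
  have m: "0 < m" "m \<le> 1" "m \<le> chi1"
    using chi by (auto simp: m_def)
  have b: "0 < b" "b < 1"
    using A by (auto simp: b_def field_simps)
  define \<mu> where "\<mu> = Min {1, a 0, a N}"
  have \<mu>: "0 < \<mu>" "\<mu> \<le> 1" "\<mu> \<le> a 0" "\<mu> \<le> a N"
    using a by (auto simp: \<mu>_def)
  \<comment> \<open>The base of \<open>c4\<close> carries an extra factor 2^(-A), which only makes
    it smaller than the constant \<mu>^(1+b) allowed by \<open>energy_lower\<close>.\<close>
  have c4: "0 \<le> c4" "c4 \<le> \<mu> powr (1 + b)"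
  proof -
    have "\<mu> / 2 powr \<alpha> N \<le> \<mu>"
      using \<mu> A by (simp add: field_simps ge_one_powr_ge_zero)
    then show "c4 \<le> \<mu> powr (1 + b)"
      unfolding c4_def \<mu>_def[symmetric] using \<mu> b by (intro powr_mono2) auto
    show "0 \<le> c4"
      by (simp add: c4_def)
  qed
  have bounds: "c1 * inverse chi1 * norm y / (1 + norm y) powr b \<le> norm (X y)"
      "norm (X y) \<le> c2 * chi1 powr b * norm y / (1 + norm y) powr b"
      "chi1 powr (- (1 - b)) * norm y powr (1 - b) - 1 \<le> norm (X y)"
      "norm (X y) \<le> c3 * norm y powr (1 - b)"
      "c4 * chi1 powi (- 2) * (norm y)\<^sup>2 / (1 + norm y) powr b \<le> X y \<bullet> y" for y
  proof -
    define v s r where "v = X y" and "s = norm v" and "r = norm y"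
    have y: "g s *\<^sub>R v + R *\<^sub>R cross3 k v = y"
      using FX[of y] F[of v] by (simp add: v_def s_def)
    have gs: "0 \<le> g s" and s: "0 \<le> s" and r: "0 \<le> r"
      using g_ge[of s] a by (auto simp: s_def r_def)
    have lower: "g s * s \<le> r" and "r \<le> (g s + R) * s"
      using norm_scale_add_cross3[OF assms(5) gs assms(7), of v] unfolding y by (auto simp: s_def r_def)
    \<comment> \<open>Since \<open>max 1 s powr \<alpha> N\<close> is at least 1, \<open>R\<close>
      is absorbed into the growth bound of \<open>g\<close>, which turns \<open>chi0\<close> into
      \<open>chi1\<close>.\<close>
    have "R * 1 \<le> R * max 1 s powr \<alpha> N"
      using assms(7) A by (intro mult_left_mono ge_one_powr_ge_zero) auto
    then have "g s + R \<le> chi1 * max 1 s powr \<alpha> N"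
      using g_upper[OF s] by (simp add: chi1_def algebra_simps)
    then have upper: "r \<le> chi1 * max 1 s powr \<alpha> N * s"
      using \<open>r \<le> (g s + R) * s\<close> s by (meson mult_right_mono order_trans)
    have "0 < chi1"
      using chi by linarith
    note ctx = A meta_eq_to_obj_eq[OF b_def] \<open>0 < chi1\<close> s r upper
    \<comment> \<open>Used with \<open>c = min (a 0) (a N)\<close> for the constant
      \<open>c2\<close>, and with \<open>c = \<mu>\<close>, where the extra bound
      \<open>\<mu> \<le> 1\<close> is at hand, for \<open>c4\<close>.\<close>
    have coeff: "c * (1 + s powr \<alpha> N) \<le> g s" if "c \<le> a 0" "c \<le> a N" for c
    proof -
      have "c * s powr \<alpha> N \<le> a N * s powr \<alpha> N"
        using that by (intro mult_right_mono) auto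
      then show ?thesis
        using g_lower[of s] that by (simp add: distrib_left)
    qed
    show "c1 * inverse chi1 * norm y / (1 + norm y) powr b \<le> norm (X y)"
      using quotient_lower[OF ctx m] by (simp add: c1_def m_def r_def s_def v_def)
    show "norm (X y) \<le> c2 * chi1 powr b * norm y / (1 + norm y) powr b"
      using quotient_upper[OF ctx lower _ coeff m, of "min (a 0) (a N)"] a
      by (simp add: c2_def c1_def m_def r_def s_def v_def)
    show "chi1 powr (- (1 - b)) * norm y powr (1 - b) - 1 \<le> norm (X y)"
      using root_lower[OF ctx] by (simp add: r_def s_def v_def)
    have "a N * s powr \<alpha> N * s \<le> g s * s"
      using g_lower[of s] a s by (intro mult_right_mono) auto
    then show "norm (X y) \<le> c3 * norm y powr (1 - b)"
      using root_upper[OF A meta_eq_to_obj_eq[OF b_def] a(2) s, of r] lower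
      by (simp add: c3_def r_def s_def v_def)
    have "v \<bullet> y = g s * s\<^sup>2"
      using inner_scale_add_cross3[of v "g s" R k] unfolding y by (simp add: s_def)
    then show "c4 * chi1 powi (- 2) * (norm y)\<^sup>2 / (1 + norm y) powr b \<le> X y \<bullet> y"
      using energy_lower[OF ctx lower \<mu>(1) coeff \<mu>(2) c4(2)] \<mu>
      by (simp add: r_def s_def v_def)
  qed
  \<comment> \<open>By Cauchy-Schwarz, the upper bounds on \<open>X y \<bullet> y\<close> are those
    on \<open>norm (X y)\<close> multiplied by \<open>norm y\<close>.\<close>
  have inner: "X y \<bullet> y \<le> C * norm y" if "norm (X y) \<le> C" for y C
    using norm_cauchy_schwarz[of "X y" y] mult_right_mono[OF that norm_ge_zero[of y]] by linarith
  have "X y \<bullet> y \<le> c2 * chi1 powr b * (norm y)\<^sup>2 / (1 + norm y) powr b" for y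
    using inner[OF bounds(2)] by (simp add: power2_eq_square mult_ac)
  moreover have "X y \<bullet> y \<le> c3 * norm y powr (2 - b)" for y
  proof -
    have "norm y powr (2 - b) = norm y powr (1 - b) * norm y"
      using powr_add[of "norm y" "1 - b" 1] by simp
    then show ?thesis
      using inner[OF bounds(4)] by (simp add: mult_ac)
  qed
  moreover have "c5 * chi1 powi (- 2) * (norm y powr (2 - b) - 1) \<le> X y \<bullet> y" for y
  proof -
    have "c4 * chi1 powi (- 2) * (2 powr (- b) * (norm y powr (2 - b) - 1))
        \<le> c4 * chi1 powi (- 2) * ((norm y)\<^sup>2 / (1 + norm y) powr b)"
      using c4 chi b by (intro mult_left_mono powr_le_quotient) auto
    then show ?thesis
      using bounds(5)[of y] by (simp add: c5_def mult_ac)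
  qed
  ultimately show ?thesis
    using bounds by blast
qed

end
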